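(* Let $m,n\ge 1$ be integers. The number of weakly decreasing recurrent configurations $(a_1,\ldots,a_m;b_1,\ldots,b_{n-1},-)$ of the Abelian sandpile model on the complete split graph $S_{m,n}$ with sink the independent vertex $w_n$ is $$\frac{1}{m}\binom{2m+n-1}{m-1}\binom{m+n-2}{m-1}.$$
   Context: The complete split graph $S_{m,n}$ has clique vertices $v_1,\ldots,v_m$ and independent vertices $w_1,\ldots,w_n$. Every two distinct clique vertices are joined by one edge, every clique vertex is joined to every independent vertex by one edge, and no two independent vertices are adjacent. Abelian sandpile model on a graph $G$ with sink $s$: a configuration assigns a non-negative integer (number of grains) to each non-sink vertex. A non-sink vertex $v$ is stable if its number of grains is strictly less than $\deg(v)$, and unstable otherwise. A configuration is stable if all non-sink vertices are stable. An unstable vertex may topple, i.e. it loses $\deg(v)$ grains and gives one grain to each neighbour; grains given to the sink disappear. Toppling unstable vertices eventually leads to a unique stable configuration, the stabilisation. A stable configuration $c$ is recurrent if it can be reached, by adding grains and toppling, from every configuration: for every configuration $d$ there is a configuration $e$ such that the stabilisation of $d+e$ is $c$. With sink $w_n$, a configuration is written $(a_1,\ldots,a_m;b_1,\ldots,b_{n-1},-)$ where $a_i$ is the number of grains at $v_i$ and $b_j$ the number of grains at $w_j$. It is weakly decreasing if $a_1\ge\cdots\ge a_m$ and $b_1\ge\cdots\ge b_{n-1}$. *)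

theory Defs
  imports Complex_Main
begin

text \<open>
  A finite simple graph is given by its vertex set \<open>V\<close> and an adjacency relation \<open>E\<close>, which is
  symmetric and irreflexive on \<open>V\<close> and is only ever evaluated on \<open>V\<close>; \<open>s\<close> is the sink.
\<close>

definition degree :: "'v set \<Rightarrow> ('v \<Rightarrow> 'v \<Rightarrow> bool) \<Rightarrow> 'v \<Rightarrow> nat" where
  "degree V E v = card {u \<in> V. E v u}"

text \<open>
  A configuration is a function on \<open>V - {s}\<close>. It is set to \<open>0\<close> everywhere else, so that equality
  and counting of configurations only depend on the values at the non-sink vertices.
\<close>

definition configurations :: "'v set \<Rightarrow> 'v \<Rightarrow> ('v \<Rightarrow> nat) set" where
  "configurations V s = {c. \<forall>v. v \<notin> V - {s} \<longrightarrow> c v = 0}"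

definition stable :: "'v set \<Rightarrow> ('v \<Rightarrow> 'v \<Rightarrow> bool) \<Rightarrow> 'v \<Rightarrow> ('v \<Rightarrow> nat) \<Rightarrow> bool" where
  "stable V E s c \<longleftrightarrow> (\<forall>v \<in> V - {s}. c v < degree V E v)"

text \<open>
  The truncated subtraction is harmless: only unstable vertices are toppled in \<open>topples\<close>.
\<close>

definition topple :: "'v set \<Rightarrow> ('v \<Rightarrow> 'v \<Rightarrow> bool) \<Rightarrow> 'v \<Rightarrow> 'v \<Rightarrow> ('v \<Rightarrow> nat) \<Rightarrow> ('v \<Rightarrow> nat)" where
  "topple V E s v c = (\<lambda>u.
     if u = v then c u - degree V E v
     else if u \<in> V - {s} \<and> E v u then c u + 1
     else c u)"

definition topples ::
  "'v set \<Rightarrow> ('v \<Rightarrow> 'v \<Rightarrow> bool) \<Rightarrow> 'v \<Rightarrow> ('v \<Rightarrow> nat) \<Rightarrow> ('v \<Rightarrow> nat) \<Rightarrow> bool" where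
  "topples V E s c c' \<longleftrightarrow>
     (\<exists>v \<in> V - {s}. degree V E v \<le> c v \<and> c' = topple V E s v c)"

definition stabilises_to ::
  "'v set \<Rightarrow> ('v \<Rightarrow> 'v \<Rightarrow> bool) \<Rightarrow> 'v \<Rightarrow> ('v \<Rightarrow> nat) \<Rightarrow> ('v \<Rightarrow> nat) \<Rightarrow> bool" where
  "stabilises_to V E s c c' \<longleftrightarrow> (topples V E s)\<^sup>*\<^sup>* c c' \<and> stable V E s c'"

definition recurrent ::
  "'v set \<Rightarrow> ('v \<Rightarrow> 'v \<Rightarrow> bool) \<Rightarrow> 'v \<Rightarrow> ('v \<Rightarrow> nat) \<Rightarrow> bool" where
  "recurrent V E s c \<longleftrightarrow>
     c \<in> configurations V s \<and> stable V E s c \<and>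
     (\<forall>d \<in> configurations V s. \<exists>e \<in> configurations V s.
        stabilises_to V E s (\<lambda>v. d v + e v) c)"

text \<open>\<open>Clique i\<close> is $v_i$ and \<open>Indep j\<close> is $w_j$; both indices start at 1.\<close>

datatype split_vertex = Clique nat | Indep nat

definition split_verts :: "nat \<Rightarrow> nat \<Rightarrow> split_vertex set" where
  "split_verts m n = Clique ` {1..m} \<union> Indep ` {1..n}"

fun split_adj :: "split_vertex \<Rightarrow> split_vertex \<Rightarrow> bool" where
  "split_adj (Clique i) (Clique j) \<longleftrightarrow> i \<noteq> j"
| "split_adj (Clique i) (Indep j) \<longleftrightarrow> True"
| "split_adj (Indep i) (Clique j) \<longleftrightarrow> True"
| "split_adj (Indep i) (Indep j) \<longleftrightarrow> False"

definition weakly_decreasing :: "nat \<Rightarrow> nat \<Rightarrow> (split_vertex \<Rightarrow> nat) \<Rightarrow> bool" where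
  "weakly_decreasing m n c \<longleftrightarrow>
     (\<forall>i j. 1 \<le> i \<and> i \<le> j \<and> j \<le> m \<longrightarrow> c (Clique j) \<le> c (Clique i)) \<and>
     (\<forall>i j. 1 \<le> i \<and> i \<le> j \<and> j \<le> n - 1 \<longrightarrow> c (Indep j) \<le> c (Indep i))"

lemma split_adj_sym: "split_adj u v \<Longrightarrow> split_adj v u"
  by (cases u; cases v) auto

lemma split_adj_irrefl: "\<not> split_adj v v"
  by (cases v) auto

end

theory Submission
  imports Defs
begin

text \<open>
  Dhar's criterion turns recurrence into inequalities: a stable configuration is recurrent iff no
  nonempty set \<open>A\<close> of non-sink vertices is a forbidden subconfiguration, that is, every nonempty \<open>A\<close>
  contains a vertex holding at least as many grains as it has neighbours in \<open>A\<close>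
  (\<open>recurrent_imp_allowed\<close>, \<open>allowed_imp_recurrent\<close>).

  In the complete split graph with \<open>a\<close> weakly decreasing, the critical sets consist of the last
  \<open>i\<close> clique vertices and all \<open>w\<^sub>j\<close> with \<open>b\<^sub>j < i\<close>. With \<open>Y\<^sub>i\<close> the number of \<open>j\<close> such that
  \<open>b\<^sub>j < i\<close>, and \<open>X\<^sub>i = a\<^sub>m\<^sub>+\<^sub>1\<^sub>-\<^sub>i + 2\<close>, the criterion becomes \<open>Y\<^sub>i + i + 1 \<le> X\<^sub>i\<close> for \<open>1 \<le> i \<le> m\<close>
  (\<open>split_allowed_iff\<close>). The numbers \<open>Y\<^sub>i\<close> determine the weakly decreasing \<open>b\<close>, by conjugation of
  partitions. Stability gives \<open>Y\<^sub>m = n - 1\<close>, and together with the inequality for \<open>i = m\<close> it forces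
  \<open>X\<^sub>m = m + n\<close>. So the configurations to be counted correspond to the sequences of \<open>m\<close> pairs of
  natural numbers \<open>(x\<^sub>t, y\<^sub>t)\<close>, the increments of \<open>X\<close> and \<open>Y\<close>, with totals \<open>m + n\<close> and \<open>n - 1\<close>,
  for which every nonempty prefix sum of \<open>x\<^sub>t - y\<^sub>t - 1\<close> is positive.

  The weights \<open>x\<^sub>t - y\<^sub>t - 1\<close> are integers with total \<open>(m + n) - (n - 1) - m = 1\<close>, so by Raney's
  cycle lemma exactly one of the \<open>m\<close> rotations of any sequence of pairs with these totals has
  positive prefix sums. Hence exactly the fraction \<open>1 / m\<close> of all pairs of compositions is good
  (\<open>card_dominating\<close>), and there are
  \<open>(2m + n - 1 choose m - 1) * (m + n - 2 choose m - 1)\<close> pairs.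
\<close>

section \<open>Dhar's criterion for recurrence\<close>

text \<open>
  This is the absence of forbidden subconfigurations in the sense of Dhar: \<open>degree A E v\<close> counts
  the neighbours of \<open>v\<close> inside \<open>A\<close>.
\<close>

definition allowed :: "'v set \<Rightarrow> ('v \<Rightarrow> 'v \<Rightarrow> bool) \<Rightarrow> 'v \<Rightarrow> ('v \<Rightarrow> nat) \<Rightarrow> bool" where
  "allowed V E s c \<longleftrightarrow> (\<forall>A. A \<subseteq> V - {s} \<longrightarrow> A \<noteq> {} \<longrightarrow> (\<exists>v\<in>A. degree A E v \<le> c v))"

lemma allowedD:
  "allowed V E s c \<Longrightarrow> A \<subseteq> V - {s} \<Longrightarrow> A \<noteq> {} \<Longrightarrow> \<exists>v\<in>A. degree A E v \<le> c v"
  by (simp add: allowed_def)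

lemma degree_mono: "finite B \<Longrightarrow> A \<subseteq> B \<Longrightarrow> degree A E v \<le> degree B E v"
  unfolding degree_def by (rule card_mono) auto

lemma degree_insert:
  assumes "finite A" "u \<notin> A"
  shows "degree (insert u A) E v = degree A E v + (if E v u then 1 else 0)"
proof -
  have "{w \<in> insert u A. E v w} = (if E v u then insert u {w \<in> A. E v w} else {w \<in> A. E v w})"
    by auto
  then show ?thesis using assms by (simp add: degree_def)
qed

text \<open>
  The only vertex that loses grains is \<open>v\<close>. If \<open>v \<in> A\<close>, a witness for \<open>A - {v}\<close> is still one for
  \<open>A\<close>: having \<open>v\<close> as an additional neighbour costs at most one grain, which \<open>v\<close> has just sent.
  If \<open>A = {v}\<close>, nothing is demanded.
\<close>

lemma allowed_topple:
  assumes fin: "finite V"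
    and sym: "symp E" and irrefl: "irreflp E"
    and al: "allowed V E s c"
    and v: "v \<in> V - {s}"
  shows "allowed V E s (topple V E s v c)"
  unfolding allowed_def
proof (intro allI impI)
  fix A assume A: "A \<subseteq> V - {s}" "A \<noteq> {}"
  have finA: "finite A" using A fin finite_subset by blast
  show "\<exists>w\<in>A. degree A E w \<le> topple V E s v c w"
  proof (cases "A \<subseteq> {v}")
    case True
    then have "{u \<in> A. E v u} = {}" using irreflpD[OF irrefl] by blast
    then have "degree A E v = 0" by (simp only: degree_def card.empty)
    moreover have "v \<in> A" using True A by blast
    ultimately show ?thesis by (metis zero_le)
  next
    case False
    let ?B = "A - {v}"
    from False A al obtain w where w: "w \<in> ?B" "degree ?B E w \<le> c w"
      unfolding allowed_def by (metis Diff_eq_empty_iff Diff_subset order_trans)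
    have "degree A E w \<le> degree (insert v ?B) E w"
      using finA by (intro degree_mono) auto
    also have "\<dots> = degree ?B E w + (if E w v then 1 else 0)"
      using finA by (intro degree_insert) auto
    also have "\<dots> \<le> topple V E s v c w"
      using w A sympD[OF sym] by (auto simp: topple_def)
    finally show ?thesis using w by blast
  qed
qed

lemma allowed_topples_rtrancl:
  assumes "finite V" "symp E" "irreflp E"
    and "(topples V E s)\<^sup>*\<^sup>* c c'" "allowed V E s c"
  shows "allowed V E s c'"
  using assms(4,5)
proof (induction rule: rtranclp_induct)
  case (step y z)
  then show ?case using allowed_topple[OF assms(1-3)]
    unfolding topples_def by auto
qed

text \<open>
  A recurrent configuration is reached from some configuration in which every non-sink vertex is
  unstable. Such a configuration is trivially allowed, and toppling keeps it so.
\<close>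

lemma recurrent_imp_allowed:
  assumes fin: "finite V" and sym: "symp E" and irrefl: "irreflp E"
    and rec: "recurrent V E s c"
  shows "allowed V E s c"
proof -
  define d where "d = (\<lambda>v. if v \<in> V - {s} then degree V E v else 0)"
  have "d \<in> configurations V s" by (auto simp: d_def configurations_def)
  with rec obtain e where e: "(topples V E s)\<^sup>*\<^sup>* (\<lambda>v. d v + e v) c"
    unfolding recurrent_def stabilises_to_def by blast
  have "allowed V E s (\<lambda>v. d v + e v)"
    unfolding allowed_def
  proof (intro allI impI)
    fix A assume A: "A \<subseteq> V - {s}" "A \<noteq> {}"
    then obtain v where v: "v \<in> A" by blast
    have "degree A E v \<le> degree V E v" using A fin by (intro degree_mono) auto
    also have "\<dots> \<le> d v + e v" using v A by (auto simp: d_def)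
    finally show "\<exists>v\<in>A. degree A E v \<le> d v + e v" using v by blast
  qed
  from allowed_topples_rtrancl[OF fin sym irrefl e this] show ?thesis .
qed

text \<open>
  Applied to a script \<open>x\<close>, which says how often each vertex topples, the reduced graph Laplacian
  gives the net loss of grains at \<open>v\<close>.
\<close>

definition laplacian :: "'v set \<Rightarrow> ('v \<Rightarrow> 'v \<Rightarrow> bool) \<Rightarrow> 'v \<Rightarrow> ('v \<Rightarrow> nat) \<Rightarrow> 'v \<Rightarrow> int" where
  "laplacian V E s x v =
     int (degree V E v) * int (x v) - (\<Sum>u\<in>{u \<in> V - {s}. E v u}. int (x u))"

lemma laplacian_scale:
  "laplacian V E s (\<lambda>u. k * x u) v = int k * laplacian V E s x v"
  by (simp add: laplacian_def algebra_simps sum_distrib_left)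

lemma laplacian_decrement:
  assumes fin: "finite V" and sym: "symp E" and irrefl: "irreflp E"
    and v: "v \<in> V - {s}" "x v > 0"
  shows "laplacian V E s (x(v := x v - 1)) w =
     laplacian V E s x w - (if w = v then int (degree V E v) else if E v w then -1 else 0)"
proof -
  let ?N = "{u \<in> V - {s}. E w u}"
  have "(\<Sum>u\<in>?N. int ((x(v := x v - 1)) u)) = (\<Sum>u\<in>?N. int (x u) - (if u = v then 1 else 0))"
    using v by (intro sum.cong) auto
  also have "\<dots> = (\<Sum>u\<in>?N. int (x u)) - (if v \<in> ?N then 1 else 0)"
    using fin by (simp add: sum_subtractf)
  finally have sum_upd: "(\<Sum>u\<in>?N. int ((x(v := x v - 1)) u)) = \<dots>" .
  have "E w v \<longleftrightarrow> E v w" using sympD[OF sym] by blast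
  with v irreflpD[OF irrefl, of v] show ?thesis
    unfolding laplacian_def sum_upd by (cases "w = v") (simp_all add: algebra_simps of_nat_diff)
qed

text \<open>
  This finds the next vertex to topple when a script \<open>x\<close> is to be executed starting from \<open>c\<close> plus
  the Laplacian of \<open>x\<close>. Let \<open>A\<close> be the set of vertices where \<open>x\<close> attains its maximum \<open>M\<close>.
  Compared with firing \<open>M\<close> times at all neighbours, a neighbour outside \<open>A\<close> (the sink included)
  sends at least one grain less, so the Laplacian at \<open>v \<in> A\<close> is at least the number of neighbours
  of \<open>v\<close> outside \<open>A\<close>. Some \<open>v \<in> A\<close> holds a grain of \<open>c\<close> for each neighbour inside \<open>A\<close>.
\<close>

lemma maximal_firing_vertex_unstable:
  assumes fin: "finite V" and al: "allowed V E s c"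
    and pos: "u \<in> V - {s}" "x u > 0"
  obtains v where "v \<in> V - {s}" "x v > 0"
    "int (degree V E v) \<le> int (c v) + laplacian V E s x v"
proof -
  define M where "M = Max (x ` (V - {s}))"
  have le: "x w \<le> M" if "w \<in> V - {s}" for w
    using that fin by (auto simp: M_def)
  have M: "M > 0" using le[OF pos(1)] pos(2) by simp
  define A where "A = {v \<in> V - {s}. x v = M}"
  have "M \<in> x ` (V - {s})" unfolding M_def using fin pos by (intro Max_in) auto
  then have "A \<noteq> {}" by (auto simp: A_def)
  moreover have "A \<subseteq> V - {s}" by (auto simp: A_def)
  ultimately obtain v where v: "v \<in> A" "degree A E v \<le> c v"
    using al unfolding allowed_def by blast
  let ?N = "{u \<in> V - {s}. E v u}"
  have finN: "finite ?N" using fin by auto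
  have "(\<Sum>u\<in>?N. int (x u)) \<le> (\<Sum>u\<in>?N. (int M - 1) + (if u \<in> A then 1 else 0))"
  proof (rule sum_mono)
    fix u assume "u \<in> ?N"
    then show "int (x u) \<le> (int M - 1) + (if u \<in> A then 1 else 0)"
      using le[of u] by (cases "x u = M") (auto simp: A_def)
  qed
  also have "\<dots> = int (card ?N) * (int M - 1) + int (card (?N \<inter> A))"
    using finN by (simp add: sum.distrib sum.If_cases)
  also have "?N \<inter> A = {u \<in> A. E v u}" by (auto simp: A_def)
  also have "int (card ?N) * (int M - 1) \<le> int (degree V E v) * (int M - 1)"
    using M fin by (intro mult_right_mono) (auto simp: degree_def intro!: card_mono)
  finally have "(\<Sum>u\<in>?N. int (x u)) \<le> int (degree V E v) * (int M - 1) + int (c v)"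
    using v(2) by (simp add: degree_def)
  moreover have "x v = M" using v by (simp add: A_def)
  ultimately have "int (degree V E v) \<le> int (c v) + laplacian V E s x v"
    by (simp add: laplacian_def algebra_simps)
  with \<open>x v = M\<close> M v show ?thesis using that by (auto simp: A_def)
qed

text \<open>
  By the preceding lemma a nonzero script can always be executed one legal step further, and what
  remains is a smaller script with the same target.
\<close>

lemma topples_script:
  assumes fin: "finite V" and sym: "symp E" and irrefl: "irreflp E"
    and al: "allowed V E s c" and c: "c \<in> configurations V s"
  shows "g \<in> configurations V s \<Longrightarrow>
     \<forall>v\<in>V - {s}. int (g v) = int (c v) + laplacian V E s x v \<Longrightarrow> (topples V E s)\<^sup>*\<^sup>* g c"
proof (induction "\<Sum>v\<in>V - {s}. x v" arbitrary: g x)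
  case 0
  then have x0: "\<forall>v\<in>V - {s}. x v = 0" using fin by simp
  have "g v = c v" for v
  proof (cases "v \<in> V - {s}")
    case True
    then have "laplacian V E s x v = 0" using x0 by (simp add: laplacian_def)
    then show ?thesis using bspec[OF 0(3) True] by simp
  next
    case False
    then show ?thesis using 0(2) c by (simp add: configurations_def)
  qed
  then have "g = c" by blast
  then show ?case by simp
next
  case (Suc k)
  have "\<exists>u\<in>V - {s}. x u > 0"
  proof (rule ccontr)
    assume "\<not> ?thesis"
    then have "(\<Sum>v\<in>V - {s}. x v) = 0" by simp
    with Suc(2) show False by simp
  qed
  then obtain u where u: "u \<in> V - {s}" "x u > 0" by blast
  obtain v where v: "v \<in> V - {s}" "x v > 0"
      "int (degree V E v) \<le> int (c v) + laplacian V E s x v"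
    by (rule maximal_firing_vertex_unstable[where x = x, OF fin al u])
  have unst: "degree V E v \<le> g v" using v(3) bspec[OF Suc.prems(2) v(1)] by simp
  let ?g = "topple V E s v g" and ?x = "x(v := x v - 1)"
  have "(\<Sum>w\<in>V - {s}. x w) = x v + (\<Sum>w\<in>V - {s} - {v}. x w)"
    using v fin by (intro sum.remove) auto
  moreover have "(\<Sum>w\<in>V - {s}. ?x w) = (x v - 1) + (\<Sum>w\<in>V - {s} - {v}. x w)"
    using v fin by (subst sum.remove[of _ v]) (auto intro!: sum.cong)
  ultimately have k: "k = (\<Sum>w\<in>V - {s}. ?x w)" using Suc(2) v(2) by simp
  have conf: "?g \<in> configurations V s"
    using Suc.prems(1) v by (auto simp: configurations_def topple_def)
  have "int (?g w) = int (c w) + laplacian V E s ?x w" if w: "w \<in> V - {s}" for w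
    using bspec[OF Suc.prems(2) w] unst w irreflpD[OF irrefl, of v]
    unfolding laplacian_decrement[where x = x, OF fin sym irrefl v(1,2)]
    by (cases "w = v") (simp_all add: topple_def of_nat_diff)
  then have "\<forall>w\<in>V - {s}. int (?g w) = int (c w) + laplacian V E s ?x w" by blast
  from Suc.hyps(1)[OF k conf this] have "(topples V E s)\<^sup>*\<^sup>* ?g c" .
  moreover have "topples V E s g ?g" using v(1) unst by (auto simp: topples_def)
  ultimately show ?case by (meson converse_rtranclp_into_rtranclp)
qed

text \<open>
  A script with positive Laplacian, repeated often enough, lifts \<open>c\<close> above any given \<open>d\<close>; executing
  it brings the lifted configuration back to \<open>c\<close>.
\<close>

lemma allowed_imp_recurrent:
  assumes fin: "finite V" and sym: "symp E" and irrefl: "irreflp E"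
    and lap: "\<And>v. v \<in> V - {s} \<Longrightarrow> laplacian V E s x v > 0"
    and c: "c \<in> configurations V s" and st: "stable V E s c" and al: "allowed V E s c"
  shows "recurrent V E s c"
  unfolding recurrent_def
proof (intro conjI ballI c st)
  fix d assume d: "d \<in> configurations V s"
  \<comment> \<open>each repetition of the script adds at least one grain everywhere, so \<open>k\<close> of them dominate \<open>d\<close>\<close>
  define k where "k = (\<Sum>v\<in>V - {s}. d v)"
  define g where "g = (\<lambda>v. if v \<in> V - {s}
     then nat (int (c v) + laplacian V E s (\<lambda>u. k * x u) v) else 0)"
  have dk: "int (d v) \<le> laplacian V E s (\<lambda>u. k * x u) v" if v: "v \<in> V - {s}" for v
  proof -
    have "d v \<le> k" unfolding k_def using v fin by (intro member_le_sum) auto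
    also have "int k * 1 \<le> int k * laplacian V E s x v"
      using lap[OF v] by (intro mult_left_mono) auto
    finally show ?thesis by (simp add: laplacian_scale)
  qed
  have gd: "d v \<le> g v" for v
    using dk[of v] d by (auto simp: g_def configurations_def)
  have gconf: "g \<in> configurations V s" by (auto simp: g_def configurations_def)
  have "(topples V E s)\<^sup>*\<^sup>* g c"
  proof (rule topples_script[OF fin sym irrefl al c gconf])
    have "int (g v) = int (c v) + laplacian V E s (\<lambda>u. k * x u) v" if v: "v \<in> V - {s}" for v
      using dk[OF v] v by (simp add: g_def)
    then show "\<forall>v\<in>V - {s}. int (g v) = int (c v) + laplacian V E s (\<lambda>u. k * x u) v"
      by blast
  qed
  moreover have "(\<lambda>v. d v + (g v - d v)) = g" using gd by auto
  moreover have "(\<lambda>v. g v - d v) \<in> configurations V s"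
    using gconf by (auto simp: configurations_def)
  ultimately show "\<exists>e\<in>configurations V s. stabilises_to V E s (\<lambda>v. d v + e v) c"
    using st unfolding stabilises_to_def by (intro bexI[of _ "\<lambda>v. g v - d v"]) simp_all
qed

section \<open>The cycle lemma and pairs of compositions\<close>

text \<open>
  Extend the partial sums \<open>S\<close> periodically, so that \<open>S (t + m) = S t + 1\<close>. The rotation starts
  after the last minimum of \<open>S\<close> on \<open>{0..<m}\<close>: the later values in this period are larger, and
  those in the next period have gained 1. Two such starting points \<open>k < k'\<close> would give the integers
  \<open>S k < S k' < S k + 1\<close>, which is impossible.
\<close>

lemma raney_unique_rotation:
  fixes f :: "nat \<Rightarrow> int"
  assumes m: "m > 0" and sum1: "(\<Sum>i<m. f i) = 1"
  shows "\<exists>!k. k < m \<and> (\<forall>l\<in>{1..m}. (\<Sum>i<l. f ((k + i) mod m)) > 0)"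
proof -
  define S where "S t = (\<Sum>i<t. f (i mod m))" for t
  have shift: "(\<Sum>i<l. f ((k + i) mod m)) = S (k + l) - S k" for k l
    by (induction l) (simp_all add: S_def)
  have Sm: "S m = 1" using sum1 by (simp add: S_def)
  have per: "S (t + m) = S t + 1" for t
    using shift[of m t] Sm by (simp add: S_def add.commute)
  have ex: "\<exists>k<m. \<forall>l\<in>{1..m}. S (k + l) - S k > 0"
  proof -
    define \<mu> where "\<mu> = Min (S ` {..<m})"
    have \<mu>: "\<mu> \<le> S t" if "t < m" for t using that by (auto simp: \<mu>_def)
    define K where "K = {t. t < m \<and> S t = \<mu>}"
    have finK: "finite K" by (simp add: K_def)
    have "\<mu> \<in> S ` {..<m}" unfolding \<mu>_def using m by (intro Min_in) auto
    then have "K \<noteq> {}" by (auto simp: K_def)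
    \<comment> \<open>the last minimum of \<open>S\<close> on one period\<close>
    define k where "k = Max K"
    have k: "k < m" "S k = \<mu>" using Max_in[OF finK \<open>K \<noteq> {}\<close>] by (auto simp: k_def K_def)
    have "S (k + l) > S k" if l: "l \<in> {1..m}" for l
    proof (cases "k + l < m")
      case True
      have "k + l \<notin> K" using Max_ge[OF finK, of "k + l"] l by (auto simp: k_def)
      then show ?thesis using True \<mu>[OF True] k by (auto simp: K_def)
    next
      case False
      then show ?thesis using per[of "k + l - m"] \<mu>[of "k + l - m"] k l by auto
    qed
    then show ?thesis using k by auto
  qed
  have uniq: False if "k < k'" "k' < m" "\<forall>l\<in>{1..m}. S (k + l) - S k > 0"
      "\<forall>l\<in>{1..m}. S (k' + l) - S k' > 0" for k k'
  proof -
    have "k' - k \<in> {1..m}" "m - (k' - k) \<in> {1..m}" using that(1,2) by auto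
    from bspec[OF that(3) this(1)] bspec[OF that(4) this(2)]
    have "S k' > S k" "S (k + m) > S k'" using that(1,2) by (simp_all add: add.commute)
    then show False using per[of k] by simp
  qed
  show ?thesis unfolding shift using ex uniq by (metis linorder_neqE_nat)
qed

text \<open>
  Double counting of the pairs of a sequence and a rotation amount that makes it good: each sequence
  has exactly one such amount, and each amount permutes \<open>\<Omega>\<close>.
\<close>

lemma cycle_lemma:
  fixes w :: "'a \<Rightarrow> int"
  assumes m: "m > 0" and fin: "finite \<Omega>"
    and len: "\<And>xs. xs \<in> \<Omega> \<Longrightarrow> length xs = m"
    and sum1: "\<And>xs. xs \<in> \<Omega> \<Longrightarrow> sum_list (map w xs) = 1"
    and rot: "\<And>xs k. xs \<in> \<Omega> \<Longrightarrow> rotate k xs \<in> \<Omega>"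
  shows "m * card {xs \<in> \<Omega>. \<forall>l\<in>{1..m}. sum_list (map w (take l xs)) > 0} = card \<Omega>"
proof -
  define good where "good xs \<longleftrightarrow> (\<forall>l\<in>{1..m}. sum_list (map w (take l xs)) > 0)" for xs
  have one: "card {k \<in> {..<m}. good (rotate k xs)} = 1" if xs: "xs \<in> \<Omega>" for xs
  proof -
    define f where "f i = w (xs ! i)" for i
    have "sum_list (map w (take l (rotate k xs))) = (\<Sum>i<l. f ((k + i) mod m))"
      if "l \<in> {1..m}" for k l
      using that len[OF xs]
      by (auto simp: sum_list_sum_nth f_def nth_rotate atLeast0LessThan intro!: sum.cong)
    then have good_iff: "good (rotate k xs) \<longleftrightarrow> (\<forall>l\<in>{1..m}. (\<Sum>i<l. f ((k + i) mod m)) > 0)" for k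
      by (simp add: good_def)
    have "(\<Sum>i<m. f i) = 1"
      using sum1[OF xs] len[OF xs] by (simp add: sum_list_sum_nth f_def atLeast0LessThan)
    from raney_unique_rotation[OF m this] obtain k0 where
      "\<And>k. k < m \<and> good (rotate k xs) \<longleftrightarrow> k = k0" unfolding good_iff[symmetric] by metis
    then have "{k \<in> {..<m}. good (rotate k xs)} = {k0}" by auto
    then show ?thesis by simp
  qed
  have same: "card {xs \<in> \<Omega>. good (rotate k xs)} = card {xs \<in> \<Omega>. good xs}" if k: "k < m" for k
  proof (rule bij_betw_same_card[of "rotate k"], rule bij_betw_byWitness[of _ "rotate (m - k)"])
    show "\<forall>xs\<in>{xs \<in> \<Omega>. good (rotate k xs)}. rotate (m - k) (rotate k xs) = xs"
      using k by (auto simp: rotate_rotate len)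
    show "\<forall>xs\<in>{xs \<in> \<Omega>. good xs}. rotate k (rotate (m - k) xs) = xs"
      using k by (auto simp: rotate_rotate len)
    show "rotate k ` {xs \<in> \<Omega>. good (rotate k xs)} \<subseteq> {xs \<in> \<Omega>. good xs}"
      using rot by auto
    show "rotate (m - k) ` {xs \<in> \<Omega>. good xs} \<subseteq> {xs \<in> \<Omega>. good (rotate k xs)}"
      using rot k by (auto simp: rotate_rotate len)
  qed
  have "card \<Omega> = (\<Sum>xs\<in>\<Omega>. card {k \<in> {..<m}. good (rotate k xs)})"
    using one by simp
  also have "\<dots> = (\<Sum>k<m. card {xs \<in> \<Omega>. good (rotate k xs)})"
    using fin by (intro sum_multicount_gen) auto
  also have "\<dots> = m * card {xs \<in> \<Omega>. good xs}" using same by simp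
  finally show ?thesis by (simp add: good_def)
qed

lemma sum_list_rotate:
  fixes xs :: "'a::comm_monoid_add list"
  shows "sum_list (rotate k xs) = sum_list xs"
proof (induction k)
  case (Suc k)
  then show ?case by (cases "rotate k xs") (simp_all add: add.commute)
qed simp

definition pair_compositions :: "nat \<Rightarrow> nat \<Rightarrow> nat \<Rightarrow> (nat \<times> nat) list set" where
  "pair_compositions m p q =
     {zs. length zs = m \<and> sum_list (map fst zs) = p \<and> sum_list (map snd zs) = q}"

lemma card_pair_compositions:
  "card (pair_compositions m p q) = ((p + m - 1) choose p) * ((q + m - 1) choose q)"
proof -
  let ?L = "\<lambda>N. {l::nat list. length l = m \<and> sum_list l = N}"
  have "bij_betw (\<lambda>zs. (map fst zs, map snd zs)) (pair_compositions m p q) (?L p \<times> ?L q)"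
    by (rule bij_betw_byWitness[of _ "\<lambda>(xs, ys). zip xs ys"])
       (auto simp: pair_compositions_def zip_map_fst_snd)
  then have "card (pair_compositions m p q) = card (?L p \<times> ?L q)" by (rule bij_betw_same_card)
  then show ?thesis by (simp add: card_cartesian_product card_length_sum_list)
qed

definition dominating :: "nat \<Rightarrow> nat \<Rightarrow> nat \<Rightarrow> (nat \<times> nat) list set" where
  "dominating m p q = {zs \<in> pair_compositions m p q.
     \<forall>i\<in>{1..m}. sum_list (map snd (take i zs)) + i + 1 \<le> sum_list (map fst (take i zs))}"

lemma card_dominating:
  assumes m: "m > 0"
  shows "m * card (dominating m (q + m + 1) q) =
    ((q + 2 * m) choose (m - 1)) * ((q + m - 1) choose (m - 1))"
proof -
  define w :: "nat \<times> nat \<Rightarrow> int" where "w z = int (fst z) - int (snd z) - 1" for z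
  have w_sum: "sum_list (map w zs) =
      int (sum_list (map fst zs)) - int (sum_list (map snd zs)) - int (length zs)" for zs
    by (induction zs) (auto simp: w_def)
  let ?\<Omega> = "pair_compositions m (q + m + 1) q"
  have "(q + m + 1 + m - 1) choose (q + m + 1) = (q + 2 * m) choose (m - 1)"
    using m binomial_symmetric[of "m - 1" "q + 2 * m"] by (simp add: mult_2 add.assoc)
  moreover have "(q + m - 1) choose q = (q + m - 1) choose (m - 1)"
    using m binomial_symmetric[of "m - 1" "q + m - 1"] by simp
  ultimately have card: "card ?\<Omega> = ((q + 2 * m) choose (m - 1)) * ((q + m - 1) choose (m - 1))"
    by (simp only: card_pair_compositions)
  then have fin: "finite ?\<Omega>" using m by (intro card_ge_0_finite) (auto simp: zero_less_binomial_iff)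
  have rot: "rotate k zs \<in> ?\<Omega>" if "zs \<in> ?\<Omega>" for zs k
    using that by (auto simp: pair_compositions_def sum_list_rotate simp flip: rotate_map)
  have "dominating m (q + m + 1) q = {zs \<in> ?\<Omega>. \<forall>i\<in>{1..m}. sum_list (map w (take i zs)) > 0}"
    by (force simp: dominating_def w_sum pair_compositions_def)
  then show ?thesis
    using cycle_lemma[OF m fin, of w] rot card
    by (simp add: w_sum pair_compositions_def)
qed

section \<open>Recurrent configurations of the complete split graph\<close>

lemma degree_split:
  assumes "finite I" "finite J"
  shows "degree (Clique ` I \<union> Indep ` J) split_adj (Clique k) = card (I - {k}) + card J"
    and "degree (Clique ` I \<union> Indep ` J) split_adj (Indep k) = card I"
proof -
  have "{u \<in> Clique ` I \<union> Indep ` J. split_adj (Clique k) u} = Clique ` (I - {k}) \<union> Indep ` J"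
    by auto
  moreover have "card \<dots> = card (I - {k}) + card J"
    using assms by (subst card_Un_disjoint) (auto simp: card_image inj_on_def)
  ultimately show "degree (Clique ` I \<union> Indep ` J) split_adj (Clique k) = card (I - {k}) + card J"
    by (simp add: degree_def)
  have "{u \<in> Clique ` I \<union> Indep ` J. split_adj (Indep k) u} = Clique ` I"
    by auto
  then show "degree (Clique ` I \<union> Indep ` J) split_adj (Indep k) = card I"
    by (simp add: degree_def card_image inj_on_def)
qed

lemma degree_split_verts:
  "k \<in> {1..m} \<Longrightarrow> degree (split_verts m n) split_adj (Clique k) = m - 1 + n"
  "degree (split_verts m n) split_adj (Indep k) = m"
  by (simp_all add: split_verts_def degree_split)

lemma nonsink_split:
  assumes "n \<ge> 1"
  shows "split_verts m n - {Indep n} = Clique ` {1..m} \<union> Indep ` {1..n - 1}"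
proof -
  have "{1..n} - {n} = {1..n - 1}" using assms by auto
  moreover have "split_verts m n - {Indep n} = Clique ` {1..m} \<union> Indep ` ({1..n} - {n})"
    by (auto simp: split_verts_def)
  ultimately show ?thesis by simp
qed

lemma weakly_decreasingD:
  assumes "weakly_decreasing m n c" "1 \<le> i" "i \<le> j"
  shows "j \<le> m \<Longrightarrow> c (Clique j) \<le> c (Clique i)"
    and "j \<le> n - 1 \<Longrightarrow> c (Indep j) \<le> c (Indep i)"
  using assms by (auto simp: weakly_decreasing_def)

text \<open>
  The script fires every clique vertex \<open>n\<close> times and every \<open>w\<^sub>j\<close> \<open>n + 1\<close> times. Its Laplacian is
  \<open>n\<^sup>2 - (n - 1) (n + 1) = 1\<close> at clique vertices and \<open>m (n + 1) - m n = m\<close> at independent ones.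
\<close>

lemma split_laplacian_pos:
  assumes m: "m \<ge> 1" and n: "n \<ge> 1" and v: "v \<in> split_verts m n - {Indep n}"
  shows "laplacian (split_verts m n) split_adj (Indep n)
     (\<lambda>u. case u of Clique _ \<Rightarrow> n | Indep _ \<Rightarrow> n + 1) v > 0"
    (is "laplacian ?V _ ?s ?x v > 0")
proof (cases v)
  case (Clique k)
  with v have k: "k \<in> {1..m}" by (auto simp: split_verts_def)
  have "{u \<in> ?V - {?s}. split_adj v u} = Clique ` ({1..m} - {k}) \<union> Indep ` {1..n - 1}"
    using n Clique by (auto simp: nonsink_split)
  moreover have "(\<Sum>u\<in>\<dots>. int (?x u)) = int (m - 1) * int n + int (n - 1) * int (n + 1)"
    using k by (subst sum.union_disjoint) (auto simp: sum.reindex inj_on_def)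
  ultimately show ?thesis
    using m n k Clique by (simp add: laplacian_def degree_split_verts of_nat_diff algebra_simps)
next
  case (Indep k)
  have "{u \<in> ?V - {?s}. split_adj v u} = Clique ` {1..m}"
    using n Indep by (auto simp: nonsink_split)
  moreover have "(\<Sum>u\<in>\<dots>. int (?x u)) = int m * int n"
    by (auto simp: sum.reindex inj_on_def)
  ultimately show ?thesis
    using m Indep by (simp add: laplacian_def degree_split_verts algebra_simps)
qed

lemma split_recurrent_iff:
  assumes "m \<ge> 1" "n \<ge> 1"
  shows "recurrent (split_verts m n) split_adj (Indep n) c \<longleftrightarrow>
    c \<in> configurations (split_verts m n) (Indep n) \<and> stable (split_verts m n) split_adj (Indep n) c \<and>
    allowed (split_verts m n) split_adj (Indep n) c"
proof -
  have fin: "finite (split_verts m n)" by (simp add: split_verts_def)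
  have sym: "symp split_adj" using split_adj_sym by (rule sympI)
  have irrefl: "irreflp split_adj" using split_adj_irrefl by (rule irreflpI)
  have "c \<in> configurations (split_verts m n) (Indep n)" "stable (split_verts m n) split_adj (Indep n) c"
    if "recurrent (split_verts m n) split_adj (Indep n) c"
    using that by (simp_all add: recurrent_def)
  then show ?thesis
    using recurrent_imp_allowed[OF fin sym irrefl]
      allowed_imp_recurrent[OF fin sym irrefl split_laplacian_pos[OF assms]] by blast
qed

definition low_count :: "nat \<Rightarrow> (split_vertex \<Rightarrow> nat) \<Rightarrow> nat \<Rightarrow> nat" where
  "low_count n c i = card {j \<in> {1..n - 1}. c (Indep j) < i}"

text \<open>
  Among the sets \<open>A\<close> with \<open>i\<close> clique vertices, the most demanding one takes the poorest clique
  vertices, \<open>v\<^sub>m\<^sub>+\<^sub>1\<^sub>-\<^sub>i, \<dots>, v\<^sub>m\<close>, and exactly those \<open>w\<^sub>j\<close> that cannot pay for their \<open>i\<close>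
  neighbours in \<open>A\<close>. The richest of these clique vertices is \<open>v\<^sub>m\<^sub>+\<^sub>1\<^sub>-\<^sub>i\<close>, and it needs one grain for
  each other member of \<open>A\<close>. Sets without clique vertices span no edges and demand nothing.
\<close>

lemma split_allowed_iff:
  assumes n: "n \<ge> 1" and dec: "weakly_decreasing m n c"
  shows "allowed (split_verts m n) split_adj (Indep n) c \<longleftrightarrow>
    (\<forall>i\<in>{1..m}. i - 1 + low_count n c i \<le> c (Clique (m + 1 - i)))"
    (is "?allowed \<longleftrightarrow> ?crit")
proof
  assume al: ?allowed
  show ?crit
  proof
    fix i assume i: "i \<in> {1..m}"
    define I where "I = {m + 1 - i..m}"
    define J where "J = {j \<in> {1..n - 1}. c (Indep j) < i}"
    have cardI: "card I = i" using i by (auto simp: I_def)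
    have "Clique ` I \<union> Indep ` J \<subseteq> split_verts m n - {Indep n}"
      using i n by (auto simp: nonsink_split I_def J_def)
    moreover have "Clique ` I \<union> Indep ` J \<noteq> {}" using i by (auto simp: I_def)
    ultimately obtain v where v: "v \<in> Clique ` I \<union> Indep ` J"
        "degree (Clique ` I \<union> Indep ` J) split_adj v \<le> c v"
      using allowedD[OF al] by metis
    have fin: "finite I" "finite J" by (auto simp: I_def J_def)
    from v(1) show "i - 1 + low_count n c i \<le> c (Clique (m + 1 - i))"
    proof
      assume "v \<in> Indep ` J"
      then show ?thesis using v(2) fin cardI by (auto simp: degree_split J_def)
    next
      assume "v \<in> Clique ` I"
      then obtain k where k: "v = Clique k" "k \<in> I" by blast
      then have "i - 1 + card J \<le> c (Clique k)"
        using v(2) fin cardI by (simp add: degree_split)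
      also have "\<dots> \<le> c (Clique (m + 1 - i))"
        using k(2) i by (intro weakly_decreasingD(1)[OF dec]) (auto simp: I_def)
      finally show ?thesis by (simp add: low_count_def J_def)
    qed
  qed
next
  assume crit: ?crit
  show ?allowed
    unfolding allowed_def
  proof (intro allI impI)
    fix A assume A: "A \<subseteq> split_verts m n - {Indep n}" "A \<noteq> {}"
    define I where "I = Clique -` A"
    define J where "J = Indep -` A"
    have IJ: "I \<subseteq> {1..m}" "J \<subseteq> {1..n - 1}" using A(1) n by (auto simp: I_def J_def nonsink_split)
    have fin: "finite I" "finite J" using IJ finite_subset by blast+
    have A_eq: "A = Clique ` I \<union> Indep ` J"
      unfolding I_def J_def by (auto simp: image_iff) (metis split_vertex.exhaust)
    show "\<exists>v\<in>A. degree A split_adj v \<le> c v"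
    proof (cases "\<exists>j\<in>J. card I \<le> c (Indep j)")
      case True
      then obtain j where j: "j \<in> J" "card I \<le> c (Indep j)" by blast
      then have "degree A split_adj (Indep j) \<le> c (Indep j)"
        using fin by (simp add: A_eq degree_split)
      then show ?thesis using j(1) by (auto simp: A_eq)
    next
      case False
      then have "I \<noteq> {}" using A(2) by (auto simp: A_eq)
      define k where "k = Min I"
      have k: "k \<in> I" using Min_in[OF fin(1) \<open>I \<noteq> {}\<close>] by (simp add: k_def)
      have "I \<subseteq> {k..m}" using IJ fin by (auto simp: k_def)
      then have "card I \<le> m + 1 - k" using card_mono[of "{k..m}" I] by simp
      moreover have "card I \<ge> 1" using \<open>I \<noteq> {}\<close> fin by (simp add: Suc_le_eq card_gt_0_iff)
      moreover have "1 \<le> k" "k \<le> m" using k IJ by auto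
      ultimately have cardI: "card I \<in> {1..m}" "1 \<le> k" "k \<le> m + 1 - card I" "m + 1 - card I \<le> m"
        by auto
      have "card J \<le> low_count n c (card I)"
        unfolding low_count_def using False IJ by (intro card_mono) auto
      then have "card I - 1 + card J \<le> c (Clique (m + 1 - card I))"
        using crit cardI(1) by force
      also have "\<dots> \<le> c (Clique k)"
        using cardI by (intro weakly_decreasingD(1)[OF dec]) auto
      finally have "degree A split_adj (Clique k) \<le> c (Clique k)"
        using k fin by (simp add: A_eq degree_split)
      then show ?thesis using k by (auto simp: A_eq)
    qed
  qed
qed

text \<open>
  Since \<open>b\<close> is weakly decreasing, the indices with \<open>b\<^sub>j < i\<close> form a final segment of
  \<open>{1..n - 1}\<close>. This is how \<open>b\<close> is recovered from its counts.
\<close>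

lemma indep_less_iff_low_count:
  assumes dec: "weakly_decreasing m n c" and k: "k \<in> {1..n - 1}"
  shows "c (Indep k) < i \<longleftrightarrow> n - k \<le> low_count n c i"
proof
  assume less: "c (Indep k) < i"
  have "c (Indep j) \<le> c (Indep k)" if "j \<in> {k..n - 1}" for j
    using k that by (intro weakly_decreasingD(2)[OF dec]) auto
  then have "{k..n - 1} \<subseteq> {j \<in> {1..n - 1}. c (Indep j) < i}"
    using less k by fastforce
  then have "card {k..n - 1} \<le> low_count n c i"
    unfolding low_count_def by (intro card_mono) auto
  then show "n - k \<le> low_count n c i" using k by simp
next
  assume le: "n - k \<le> low_count n c i"
  show "c (Indep k) < i"
  proof (rule ccontr)
    assume "\<not> c (Indep k) < i"
    moreover have "c (Indep k) \<le> c (Indep j)" if "j \<in> {1..k}" for j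
      using k that by (intro weakly_decreasingD(2)[OF dec]) auto
    ultimately have "{j \<in> {1..n - 1}. c (Indep j) < i} \<subseteq> {k + 1..n - 1}"
      by (fastforce simp: not_less)
    then have "low_count n c i \<le> card {k + 1..n - 1}"
      unfolding low_count_def by (intro card_mono) auto
    then have "low_count n c i \<le> n - 1 - k" by simp
    moreover have "n - 1 - k < n - k" using k by auto
    ultimately show False using le by simp
  qed
qed

definition sorted_recurrent :: "nat \<Rightarrow> nat \<Rightarrow> (split_vertex \<Rightarrow> nat) set" where
  "sorted_recurrent m n =
     {c. recurrent (split_verts m n) split_adj (Indep n) c \<and> weakly_decreasing m n c}"

lemma sorted_recurrent_iff:
  assumes m: "m \<ge> 1" and n: "n \<ge> 1"
  shows "c \<in> sorted_recurrent m n \<longleftrightarrow>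
    c \<in> configurations (split_verts m n) (Indep n) \<and> weakly_decreasing m n c \<and>
    (\<forall>k\<in>{1..m}. c (Clique k) \<le> m + n - 2) \<and> (\<forall>j\<in>{1..n - 1}. c (Indep j) < m) \<and>
    (\<forall>i\<in>{1..m}. i - 1 + low_count n c i \<le> c (Clique (m + 1 - i)))"
proof -
  have "stable (split_verts m n) split_adj (Indep n) c \<longleftrightarrow>
    (\<forall>k\<in>{1..m}. c (Clique k) < degree (split_verts m n) split_adj (Clique k)) \<and>
    (\<forall>j\<in>{1..n - 1}. c (Indep j) < degree (split_verts m n) split_adj (Indep j))"
    unfolding stable_def nonsink_split[OF n] ball_Un by blast
  also have "\<dots> \<longleftrightarrow>
    (\<forall>k\<in>{1..m}. c (Clique k) < m - 1 + n) \<and> (\<forall>j\<in>{1..n - 1}. c (Indep j) < m)"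
    by (intro arg_cong2[of _ _ _ _ "(\<and>)"] ball_cong refl) (simp_all only: degree_split_verts)
  also have "(\<forall>k\<in>{1..m}. c (Clique k) < m - 1 + n) \<longleftrightarrow> (\<forall>k\<in>{1..m}. c (Clique k) \<le> m + n - 2)"
    using m n by (intro ball_cong) auto
  finally show ?thesis
    using split_allowed_iff[OF n, of m c]
    unfolding sorted_recurrent_def mem_Collect_eq split_recurrent_iff[OF m n] by blast
qed

lemma sorted_recurrentD:
  assumes m: "m \<ge> 1" and n: "n \<ge> 1" and c: "c \<in> sorted_recurrent m n"
  shows "c \<in> configurations (split_verts m n) (Indep n)" "weakly_decreasing m n c"
    and "k \<in> {1..m} \<Longrightarrow> c (Clique k) \<le> m + n - 2"
    and "j \<in> {1..n - 1} \<Longrightarrow> c (Indep j) < m"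
    and "i \<in> {1..m} \<Longrightarrow> i - 1 + low_count n c i \<le> c (Clique (m + 1 - i))"
  using c unfolding sorted_recurrent_iff[OF m n] by blast+

section \<open>The bijection with dominating pairs of compositions\<close>

text \<open>
  The partial sums of the first components are \<open>X\<^sub>i = a\<^sub>m\<^sub>+\<^sub>1\<^sub>-\<^sub>i + 2\<close>, those of the second
  components are \<open>Y\<^sub>i = low_count n c i\<close>. The shift by 2 turns \<open>i - 1 + Y\<^sub>i \<le> a\<^sub>m\<^sub>+\<^sub>1\<^sub>-\<^sub>i\<close> into
  \<open>Y\<^sub>i + i + 1 \<le> X\<^sub>i\<close>, which is positivity of the prefix sums in the cycle lemma.
\<close>

definition increments :: "nat \<Rightarrow> nat \<Rightarrow> (split_vertex \<Rightarrow> nat) \<Rightarrow> (nat \<times> nat) list" where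
  "increments m n c = map (\<lambda>t.
     (if t = 0 then c (Clique m) + 2 else c (Clique (m - t)) - c (Clique (m + 1 - t)),
      card {j \<in> {1..n - 1}. c (Indep j) = t})) [0..<m]"

lemma sum_fst_increments:
  assumes dec: "weakly_decreasing m n c" and i: "i \<in> {1..m}"
  shows "sum_list (map fst (take i (increments m n c))) = c (Clique (m + 1 - i)) + 2"
proof -
  have "1 \<le> i" using i by simp
  then show ?thesis using i
  proof (induction i rule: dec_induct)
    case base
    then show ?case by (simp add: increments_def take_map)
  next
    case (step i)
    have "c (Clique (m + 1 - i)) \<le> c (Clique (m - i))"
      using step by (intro weakly_decreasingD(1)[OF dec]) auto
    then show ?case using step by (simp add: increments_def take_map)
  qed
qed

lemma sum_snd_increments:
  assumes "i \<le> m"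
  shows "sum_list (map snd (take i (increments m n c))) = low_count n c i"
  using assms
proof (induction i)
  case 0
  then show ?case by (simp add: low_count_def)
next
  case (Suc i)
  have "{j \<in> {1..n - 1}. c (Indep j) < Suc i} =
      {j \<in> {1..n - 1}. c (Indep j) < i} \<union> {j \<in> {1..n - 1}. c (Indep j) = i}"
    by auto
  then have "low_count n c (Suc i) = low_count n c i + card {j \<in> {1..n - 1}. c (Indep j) = i}"
    unfolding low_count_def by (simp only:) (rule card_Un_disjoint; auto)
  then show ?case using Suc by (simp add: increments_def take_map)
qed

lemma low_count_full: "\<forall>j\<in>{1..n - 1}. c (Indep j) < m \<Longrightarrow> low_count n c m = n - 1"
proof -
  assume "\<forall>j\<in>{1..n - 1}. c (Indep j) < m"
  then have "{j \<in> {1..n - 1}. c (Indep j) < m} = {1..n - 1}" by blast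
  then show ?thesis by (simp add: low_count_def)
qed

text \<open>
  The total of the first components is forced: by stability \<open>a\<^sub>1 \<le> m + n - 2\<close>, and the inequality
  for \<open>i = m\<close>, where every \<open>b\<^sub>j\<close> is counted, says \<open>m - 1 + (n - 1) \<le> a\<^sub>1\<close>.
\<close>

lemma increments_dominating:
  assumes m: "m \<ge> 1" and n: "n \<ge> 1" and c: "c \<in> sorted_recurrent m n"
  shows "increments m n c \<in> dominating m (n - 1 + m + 1) (n - 1)"
proof -
  note c' = sorted_recurrentD[OF m n c]
  have len: "length (increments m n c) = m" by (simp add: increments_def)
  have lm: "low_count n c m = n - 1" using c'(4) by (intro low_count_full) blast
  have mm: "m \<in> {1..m}" using m by simp
  have "m - 1 + low_count n c m \<le> c (Clique 1)" using c'(5)[OF mm] by simp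
  moreover have "c (Clique 1) \<le> m + n - 2" using c'(3)[of 1] m by simp
  ultimately have top: "c (Clique 1) = m + n - 2" using lm m n by simp
  have "sum_list (map fst (increments m n c)) = n - 1 + m + 1"
    using sum_fst_increments[OF c'(2) mm] len top m n by simp
  moreover have "sum_list (map snd (increments m n c)) = n - 1"
    using sum_snd_increments[of m m n c] len lm by simp
  moreover have "sum_list (map snd (take i (increments m n c))) + i + 1
      \<le> sum_list (map fst (take i (increments m n c)))" if i: "i \<in> {1..m}" for i
  proof -
    have "i \<ge> 1" "i \<le> m" using i by simp_all
    then show ?thesis
      using c'(5)[OF i] sum_fst_increments[OF c'(2) i] sum_snd_increments[of i m n c] by linarith
  qed
  ultimately show ?thesis by (simp add: dominating_def pair_compositions_def len)
qed

lemma inj_on_increments: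
  assumes m: "m \<ge> 1" and n: "n \<ge> 1"
  shows "inj_on (increments m n) (sorted_recurrent m n)"
proof (rule inj_onI, rule ext)
  fix c d v
  assume c: "c \<in> sorted_recurrent m n" and d: "d \<in> sorted_recurrent m n"
    and eq: "increments m n c = increments m n d"
  note c' = sorted_recurrentD[OF m n c] and d' = sorted_recurrentD[OF m n d]
  show "c v = d v"
  proof (cases "v \<in> split_verts m n - {Indep n}")
    case False
    then show ?thesis using c'(1) d'(1) by (simp add: configurations_def)
  next
    case True
    then consider (clique) k where "v = Clique k" "k \<in> {1..m}"
      | (indep) k where "v = Indep k" "k \<in> {1..n - 1}"
      using n by (auto simp: nonsink_split)
    then show ?thesis
    proof cases
      case clique
      then have "m + 1 - k \<in> {1..m}" "m + 1 - (m + 1 - k) = k" by auto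
      then show ?thesis
        using sum_fst_increments[OF c'(2), of "m + 1 - k"] sum_fst_increments[OF d'(2), of "m + 1 - k"]
          eq clique by simp
    next
      case indep
      have "c (Indep k) < i \<longleftrightarrow> d (Indep k) < i" if "i \<le> m" for i
        using sum_snd_increments[OF that, of n c] sum_snd_increments[OF that, of n d] eq
        by (simp only: indep_less_iff_low_count[OF c'(2) indep(2)]
            indep_less_iff_low_count[OF d'(2) indep(2)])
      moreover have "c (Indep k) < m" "d (Indep k) < m" using c'(4) d'(4) indep(2) by blast+
      ultimately show ?thesis
        using indep by (metis less_imp_le_nat linorder_neqE_nat order.irrefl)
    qed
  qed
qed

lemma prefix_sums_inject:
  fixes xs ys :: "'a::cancel_comm_monoid_add list"
  assumes "length xs = m" "length ys = m"
    and "\<And>i. i \<le> m \<Longrightarrow> sum_list (take i xs) = sum_list (take i ys)"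
  shows "xs = ys"
proof (rule nth_equalityI)
  fix i assume i: "i < length xs"
  show "xs ! i = ys ! i"
    using assms(3)[of i] assms(3)[of "Suc i"] i assms(1,2) by (simp add: take_Suc_conv_app_nth)
qed (simp add: assms)

text \<open>
  The preimage takes \<open>a\<close> from the partial sums \<open>X\<close> and \<open>b\<close> from the conjugate of \<open>Y\<close>:
  \<open>b\<^sub>k\<close> is the number of \<open>i\<close> with \<open>Y\<^sub>i < n - k\<close>. As \<open>Y\<close> is weakly increasing, these \<open>i\<close> form an
  initial segment, so \<open>b\<^sub>k < i\<close> iff \<open>n - k \<le> Y\<^sub>i\<close>.
\<close>

lemma dominating_is_increments:
  assumes m: "m \<ge> 1" and n: "n \<ge> 1" and zs: "zs \<in> dominating m (n - 1 + m + 1) (n - 1)"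
  shows "zs \<in> increments m n ` sorted_recurrent m n"
proof -
  define X where "X i = sum_list (map fst (take i zs))" for i
  define Y where "Y i = sum_list (map snd (take i zs))" for i
  have len: "length zs = m" and X_m: "X m = m + n" and Y_m: "Y m = n - 1"
    and dom: "\<And>i. i \<in> {1..m} \<Longrightarrow> Y i + i + 1 \<le> X i"
    using zs n by (auto simp: dominating_def pair_compositions_def X_def Y_def)
  have take_mono: "take j zs = take i zs @ take (j - i) (drop i zs)" if "i \<le> j" for i j
    using that by (metis le_add_diff_inverse take_add)
  have X_mono: "X i \<le> X j" and Y_mono: "Y i \<le> Y j" if "i \<le> j" for i j
    unfolding X_def Y_def take_mono[OF that] by simp_all
  define c where "c v = (case v of
      Clique k \<Rightarrow> if k \<in> {1..m} then X (m + 1 - k) - 2 else 0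
    | Indep k \<Rightarrow> if k \<in> {1..n - 1} then card {i \<in> {1..m}. Y i < n - k} else 0)" for v
  have clique: "c (Clique (m + 1 - i)) + 2 = X i" if i: "i \<in> {1..m}" for i
    using i dom[OF i] by (auto simp: c_def)
  have indep: "c (Indep k) < i \<longleftrightarrow> n - k \<le> Y i" if k: "k \<in> {1..n - 1}" and i: "i \<in> {1..m}" for k i
  proof
    assume "c (Indep k) < i"
    show "n - k \<le> Y i"
    proof (rule ccontr)
      assume "\<not> n - k \<le> Y i"
      then have "{1..i} \<subseteq> {i \<in> {1..m}. Y i < n - k}"
        using i by (auto simp: not_le intro: le_less_trans[OF Y_mono])
      then have "card {1..i} \<le> card {i \<in> {1..m}. Y i < n - k}" by (intro card_mono) auto
      then have "i \<le> c (Indep k)" using k by (simp add: c_def)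
      with \<open>c (Indep k) < i\<close> show False by simp
    qed
  next
    assume le: "n - k \<le> Y i"
    have "{i \<in> {1..m}. Y i < n - k} \<subseteq> {1..<i}"
    proof
      fix i' assume "i' \<in> {i \<in> {1..m}. Y i < n - k}"
      then show "i' \<in> {1..<i}" using le Y_mono[of i i'] by (cases "i \<le> i'") auto
    qed
    then have "card {i \<in> {1..m}. Y i < n - k} \<le> card {1..<i}" by (intro card_mono) auto
    then have "c (Indep k) \<le> card {1..<i}" using k by (simp add: c_def)
    moreover have "card {1..<i} < i" using i by simp
    ultimately show "c (Indep k) < i" by (rule le_less_trans)
  qed
  have low: "low_count n c i = Y i" if i: "i \<in> {1..m}" for i
  proof -
    have le: "Y i \<le> n - 1" using Y_mono[of i m] Y_m i by simp
    have "{j \<in> {1..n - 1}. c (Indep j) < i} = {j \<in> {1..n - 1}. n - j \<le> Y i}"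
      using indep[OF _ i] by blast
    also have "\<dots> = {n - Y i..n - 1}" using le n by auto
    also have "card \<dots> = Y i" using le n by simp
    finally show ?thesis by (simp add: low_count_def)
  qed
  have dec: "weakly_decreasing m n c"
    unfolding weakly_decreasing_def
  proof (intro conjI allI impI)
    fix i j assume "1 \<le> i \<and> i \<le> j \<and> j \<le> m"
    then show "c (Clique j) \<le> c (Clique i)"
      by (auto simp: c_def intro!: diff_le_mono X_mono)
  next
    fix i j assume ij: "1 \<le> i \<and> i \<le> j \<and> j \<le> n - 1"
    then have "card {l \<in> {1..m}. Y l < n - j} \<le> card {l \<in> {1..m}. Y l < n - i}"
      by (intro card_mono) auto
    then show "c (Indep j) \<le> c (Indep i)" using ij by (simp add: c_def)
  qed
  have conf: "c \<in> configurations (split_verts m n) (Indep n)"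
    using n by (auto simp: configurations_def nonsink_split c_def split: split_vertex.splits)
  have clique_le: "c (Clique k) \<le> m + n - 2" if "k \<in> {1..m}" for k
  proof -
    have "X (m + 1 - k) \<le> X m" using that by (intro X_mono) auto
    then show ?thesis using that X_m by (simp add: c_def)
  qed
  have indep_less: "c (Indep j) < m" if "j \<in> {1..n - 1}" for j
  proof -
    have "n - j \<le> Y m" using that Y_m by auto
    then show ?thesis using indep[OF that, of m] m by simp
  qed
  have crit: "i - 1 + low_count n c i \<le> c (Clique (m + 1 - i))" if i: "i \<in> {1..m}" for i
    using clique[OF i] low[OF i] dom[OF i] i by simp
  have "c \<in> sorted_recurrent m n"
    unfolding sorted_recurrent_iff[OF m n] using dec conf clique_le indep_less crit by blast
  moreover have "zs = increments m n c"
  proof -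
    have len': "length (increments m n c) = m" by (simp add: increments_def)
    have prefix: "sum_list (take i (map fst zs)) = sum_list (take i (map fst (increments m n c)))"
      "sum_list (take i (map snd zs)) = sum_list (take i (map snd (increments m n c)))" if "i \<le> m" for i
      using sum_fst_increments[OF dec, of i] sum_snd_increments[OF that, of n c]
        clique[of i] low[of i] that
      by (cases "i = 0"; simp add: X_def Y_def take_map)+
    have "map fst zs = map fst (increments m n c)" "map snd zs = map snd (increments m n c)"
      by (rule prefix_sums_inject[of _ m]; simp add: len len' prefix)+
    then show ?thesis by (metis zip_map_fst_snd)
  qed
  ultimately show ?thesis by blast
qed

theorem proposition3p7:
  fixes m n :: nat
  assumes "m \<ge> 1" and "n \<ge> 1"
  shows "real (card {c. recurrent (split_verts m n) split_adj (Indep n) c \<and>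
                        weakly_decreasing m n c})
       = 1 / real m * real ((2 * m + n - 1) choose (m - 1)) * real ((m + n - 2) choose (m - 1))"
proof -
  let ?D = "dominating m (n - 1 + m + 1) (n - 1)"
  have "bij_betw (increments m n) (sorted_recurrent m n) ?D"
    unfolding bij_betw_def
    using assms inj_on_increments increments_dominating dominating_is_increments by blast
  then have "card (sorted_recurrent m n) = card ?D" by (rule bij_betw_same_card)
  moreover have "m * card ?D = ((2 * m + n - 1) choose (m - 1)) * ((m + n - 2) choose (m - 1))"
  proof -
    have "n - 1 + 2 * m = 2 * m + n - 1" "n - 1 + m - 1 = m + n - 2" using assms by simp_all
    then show ?thesis using card_dominating[of m "n - 1"] assms by simp
  qed
  ultimately have "real m * real (card (sorted_recurrent m n)) =
      real ((2 * m + n - 1) choose (m - 1)) * real ((m + n - 2) choose (m - 1))"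
    by (metis of_nat_mult)
  then show ?thesis using assms by (simp add: sorted_recurrent_def field_simps)
qed

end
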